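(* Let $p,q,r$ be distinct primes. In the cozero-divisor graph $\Gamma'(\mathbb{Z}_{pqr}[x]/(x^2))$, every vertex belonging to the set $\mathcal{A}_{x_1,x_2,x_3}$ is adjacent to every vertex in the set $\mathcal{A}_{y_1,y_2,y_3}$ whenever there exist indices $i,j\in\{1,2,3\}$ such that $x_i<y_i$ and $x_j>y_j$ (here $x_1,x_2,x_3,y_1,y_2,y_3\in\{1,2,3\}$).
   Context: For a commutative ring $R$ with nonzero identity, the cozero-divisor graph $\Gamma'(R)$ is the simple undirected graph whose vertices are the nonzero non-unit elements of $R$, with two distinct vertices $u,v$ adjacent if and only if $u\notin Rv$ and $v\notin Ru$. $\mathbb{Z}_n$ denotes the ring of integers modulo $n$. By the Chinese remainder theorem, $\mathbb{Z}_{pqr}[x]/(x^2)\cong \mathbb{Z}_p[x]/(x^2)\times \mathbb{Z}_q[x]/(x^2)\times \mathbb{Z}_r[x]/(x^2)$; for $f=ax+b\in\mathbb{Z}_{pqr}[x]/(x^2)$ let $f_p,f_q,f_r$ denote its images in the three factors. In $\mathbb{Z}_p[x]/(x^2)$ put $I_1=\langle 0\rangle$, $I_2=\langle x\rangle$, $I_3=\mathbb{Z}_p[x]/(x^2)$; in $\mathbb{Z}_q[x]/(x^2)$ put $J_1=\langle 0\rangle$, $J_2=\langle x\rangle$, $J_3=\mathbb{Z}_q[x]/(x^2)$; in $\mathbb{Z}_r[x]/(x^2)$ put $K_1=\langle 0\rangle$, $K_2=\langle x\rangle$, $K_3=\mathbb{Z}_r[x]/(x^2)$. For $i,j,k\in\{1,2,3\}$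 define \[ \mathcal{A}_{i,j,k}=\{f\in\mathbb{Z}_{pqr}[x]/(x^2): \langle f_p\rangle=I_i,\ \langle f_q\rangle=J_j,\ \langle f_r\rangle=K_k\}. \] ($\mathcal{A}_{1,1,1}=\{0\}$ and $\mathcal{A}_{3,3,3}$, the set of units, are not part of the vertex set.) *)

theory Defs
  imports
    "HOL-Algebra.QuotRing"
    "HOL-Number_Theory.Residues"
    "Graph_Theory.Pair_Digraph"
begin

section \<open>The cozero-divisor graph\<close>

text \<open>
  A simple undirected graph is represented as a symmetric loop-free relation on the vertices.
  The ideal generated by a single element \<open>v\<close>, \<open>PIdl\<^bsub>R\<^esub> v = {x \<otimes>\<^bsub>R\<^esub> v |x. x \<in> carrier R}\<close>, is \<open>Rv\<close>.
\<close>

definition cozero_divisor_graph :: "('a, 'm) ring_scheme \<Rightarrow> 'a pair_pre_digraph" where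
  "cozero_divisor_graph R =
    (let V = carrier R - {\<zero>\<^bsub>R\<^esub>} - Units R in
      \<lparr> pverts = V,
        parcs = {(u, v). u \<in> V \<and> v \<in> V \<and> u \<noteq> v \<and> u \<notin> PIdl\<^bsub>R\<^esub> v \<and> v \<notin> PIdl\<^bsub>R\<^esub> u} \<rparr>)"

lemma cozero_divisor_graph_simple: "pair_bidirected_digraph (cozero_divisor_graph R)"
  by unfold_locales
    (auto simp: cozero_divisor_graph_def Let_def symmetric_def sym_def)

section \<open>The rings \<open>\<int>\<^sub>n[x]/(x\<^sup>2)\<close>\<close>

abbreviation Zmod_poly :: "nat \<Rightarrow> (int, nat \<Rightarrow> int) up_ring" where
  "Zmod_poly n \<equiv> UP (residue_ring (int n))"

definition poly_X :: "nat \<Rightarrow> nat \<Rightarrow> int" where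
  "poly_X n = up_ring.monom (Zmod_poly n) \<one>\<^bsub>residue_ring (int n)\<^esub> 1"

definition X2_ideal :: "nat \<Rightarrow> (nat \<Rightarrow> int) set" where
  "X2_ideal n = PIdl\<^bsub>Zmod_poly n\<^esub> (poly_X n [^]\<^bsub>Zmod_poly n\<^esub> (2::nat))"

definition Zmod_X2 :: "nat \<Rightarrow> (nat \<Rightarrow> int) set ring" where
  "Zmod_X2 n = Zmod_poly n Quot X2_ideal n"

definition X2_class :: "nat \<Rightarrow> (nat \<Rightarrow> int) \<Rightarrow> (nat \<Rightarrow> int) set" where
  "X2_class n g = X2_ideal n +>\<^bsub>Zmod_poly n\<^esub> g"

section \<open>Images in the factors of the Chinese remainder decomposition\<close>

text \<open>
  Polynomials in \<^const>\<open>UP\<close> are coefficient functions, so this is reduction of all coefficients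
  modulo \<open>p\<close>.
\<close>

definition poly_reduce :: "nat \<Rightarrow> (nat \<Rightarrow> int) \<Rightarrow> nat \<Rightarrow> int" where
  "poly_reduce p g = (\<lambda>i. g i mod int p)"

text \<open>
  The map \<open>\<int>\<^sub>n[x]/(x\<^sup>2) \<rightarrow> \<int>\<^sub>p[x]/(x\<^sup>2)\<close> induced by reduction modulo \<open>p\<close>, intended for \<open>p\<close> dividing \<open>n\<close>.
  The class in the image does not depend on the representative \<open>g\<close> (lemma \<open>crt_component_class\<close>
  below), so \<^const>\<open>the_elem\<close> is applied to a singleton.
\<close>

definition crt_component :: "nat \<Rightarrow> (nat \<Rightarrow> int) set \<Rightarrow> (nat \<Rightarrow> int) set" where
  "crt_component p f = the_elem ((\<lambda>g. X2_class p (poly_reduce p g)) ` f)"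

section \<open>The sets \<open>\<A>\<^sub>i\<^sub>,\<^sub>j\<^sub>,\<^sub>k\<close>\<close>

text \<open>
  The ideals \<open>\<langle>0\<rangle>\<close>, \<open>\<langle>x\<rangle>\<close> and the whole ring, indexed by 1, 2, 3; other indices are never used.
\<close>

definition chain_ideal :: "nat \<Rightarrow> nat \<Rightarrow> (nat \<Rightarrow> int) set set" where
  "chain_ideal p i =
    (if i = 1 then PIdl\<^bsub>Zmod_X2 p\<^esub> \<zero>\<^bsub>Zmod_X2 p\<^esub>
     else if i = 2 then PIdl\<^bsub>Zmod_X2 p\<^esub> (X2_class p (poly_X p))
     else carrier (Zmod_X2 p))"

definition ideal_type_class ::
  "nat \<Rightarrow> nat \<Rightarrow> nat \<Rightarrow> nat \<Rightarrow> nat \<Rightarrow> nat \<Rightarrow> (nat \<Rightarrow> int) set set" where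
  "ideal_type_class p q r i j k =
    {f \<in> carrier (Zmod_X2 (p * q * r)).
       PIdl\<^bsub>Zmod_X2 p\<^esub> (crt_component p f) = chain_ideal p i \<and>
       PIdl\<^bsub>Zmod_X2 q\<^esub> (crt_component q f) = chain_ideal q j \<and>
       PIdl\<^bsub>Zmod_X2 r\<^esub> (crt_component r f) = chain_ideal r k}"

section \<open>Well-definedness of \<^const>\<open>crt_component\<close>\<close>

lemma UP_cring_Zmod: "n > 1 \<Longrightarrow> UP_cring (residue_ring (int n))"
  by (simp add: UP_cring_def residues.cring residues_def)

lemma ideal_X2:
  assumes "n > 1"
  shows "ideal (X2_ideal n) (Zmod_poly n)"
proof -
  interpret UP_cring "residue_ring (int n)" "Zmod_poly n"
    using UP_cring_Zmod[OF assms] by simp_all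
  show ?thesis
    unfolding X2_ideal_def poly_X_def by (intro P.cgenideal_ideal P.nat_pow_closed monom_closed R.one_closed)
qed

lemma mod_hom:
  assumes "p > 1" "n > 1" "p dvd n"
  shows "(\<lambda>a. a mod int p) \<in> ring_hom (residue_ring (int n)) (residue_ring (int p))"
  using assms
  by (intro ring_hom_memI)
     (auto simp: residue_ring_def mod_mod_cancel mod_mult_eq mod_add_eq)

lemma poly_reduce_hom:
  assumes "p > 1" "n > 1" "p dvd n"
  shows "poly_reduce p \<in> ring_hom (Zmod_poly n) (Zmod_poly p)"
proof -
  interpret h: ring_hom_cring "residue_ring (int n)" "residue_ring (int p)" "\<lambda>a. a mod int p"
    using mod_hom[OF assms] assms
    by (simp add: ring_hom_cring_def ring_hom_cring_axioms_def residues.cring residues_def)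
  have cl: "poly_reduce p g \<in> up (residue_ring (int p))" if "g \<in> up (residue_ring (int n))" for g
  proof -
    from that obtain k where k: "bound \<zero>\<^bsub>residue_ring (int n)\<^esub> k g"
      and c: "\<And>i. g i \<in> carrier (residue_ring (int n))"
      by (auto simp: up_def)
    have "bound \<zero>\<^bsub>residue_ring (int p)\<^esub> k (poly_reduce p g)"
      using k h.hom_zero by (auto simp: bound_def poly_reduce_def)
    moreover have "poly_reduce p g i \<in> carrier (residue_ring (int p))" for i
      using h.hom_closed[OF c] by (simp add: poly_reduce_def)
    ultimately show ?thesis by (auto simp: up_def)
  qed
  show ?thesis
  proof (rule ring_hom_memI)
    fix f g assume "f \<in> carrier (Zmod_poly n)" "g \<in> carrier (Zmod_poly n)"
    then have u: "f \<in> up (residue_ring (int n))" "g \<in> up (residue_ring (int n))"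
      by (simp_all add: UP_def)
    then have c: "\<And>i. f i \<in> carrier (residue_ring (int n))" "\<And>i. g i \<in> carrier (residue_ring (int n))"
      by (auto simp: up_def)
    show "poly_reduce p f \<in> carrier (Zmod_poly p)"
      using cl u by (simp add: UP_def)
    show "poly_reduce p (f \<oplus>\<^bsub>Zmod_poly n\<^esub> g) = poly_reduce p f \<oplus>\<^bsub>Zmod_poly p\<^esub> poly_reduce p g"
      using u cl[OF u(1)] cl[OF u(2)] c h.hom_add by (simp add: UP_def poly_reduce_def)
    show "poly_reduce p (f \<otimes>\<^bsub>Zmod_poly n\<^esub> g) = poly_reduce p f \<otimes>\<^bsub>Zmod_poly p\<^esub> poly_reduce p g"
      using u cl[OF u(1)] cl[OF u(2)] c
      by (simp add: UP_def poly_reduce_def h.hom_finsum Pi_def o_def)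
  next
    show "poly_reduce p \<one>\<^bsub>Zmod_poly n\<^esub> = \<one>\<^bsub>Zmod_poly p\<^esub>"
      using h.hom_one h.hom_zero by (auto simp: UP_def poly_reduce_def)
  qed
qed

lemma poly_reduce_X:
  assumes "p > 1" "n > 1"
  shows "poly_reduce p (poly_X n) = poly_X p"
  using assms by (simp add: fun_eq_iff poly_reduce_def poly_X_def UP_def residue_ring_def)

lemma crt_component_class:
  assumes "p > 1" "n > 1" "p dvd n" "g \<in> carrier (Zmod_poly n)"
  shows "crt_component p (X2_class n g) = X2_class p (poly_reduce p g)"
proof -
  interpret N: UP_cring "residue_ring (int n)" "Zmod_poly n"
    using UP_cring_Zmod[OF assms(2)] by simp_all
  interpret M: UP_cring "residue_ring (int p)" "Zmod_poly p"
    using UP_cring_Zmod[OF assms(1)] by simp_all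
  interpret h: ring_hom_cring "Zmod_poly n" "Zmod_poly p" "poly_reduce p"
    using poly_reduce_hom[OF assms(1-3)] by unfold_locales
  interpret I: ideal "X2_ideal n" "Zmod_poly n" by (rule ideal_X2) fact
  interpret J: ideal "X2_ideal p" "Zmod_poly p" by (rule ideal_X2) fact
  have X: "poly_X n \<in> carrier (Zmod_poly n)"
    unfolding poly_X_def by (intro N.monom_closed N.R.one_closed)
  have "X2_class p (poly_reduce p k) = X2_class p (poly_reduce p g)" if "k \<in> X2_class n g" for k
  proof -
    from that[unfolded X2_class_def X2_ideal_def a_r_coset_def' cgenideal_def] obtain a where a: "a \<in> carrier (Zmod_poly n)"
      and k: "k = a \<otimes>\<^bsub>Zmod_poly n\<^esub> (poly_X n [^]\<^bsub>Zmod_poly n\<^esub> (2::nat)) \<oplus>\<^bsub>Zmod_poly n\<^esub> g"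
      by blast
    have "poly_reduce p k =
      poly_reduce p a \<otimes>\<^bsub>Zmod_poly p\<^esub> (poly_X p [^]\<^bsub>Zmod_poly p\<^esub> (2::nat)) \<oplus>\<^bsub>Zmod_poly p\<^esub> poly_reduce p g"
      unfolding k using a X assms(4)
      by (simp only: h.hom_add h.hom_mult N.P.m_closed N.P.nat_pow_closed
          h.hom_pow poly_reduce_X[OF assms(1,2)])
    then have "poly_reduce p k \<in> X2_class p (poly_reduce p g)"
      unfolding X2_class_def X2_ideal_def a_r_coset_def' cgenideal_def
      using h.hom_closed[OF a] by blast
    then show ?thesis
      unfolding X2_class_def
      by (intro J.a_repr_independence'[symmetric] h.hom_closed assms(4))
  qed
  moreover have "g \<in> X2_class n g"
    unfolding X2_class_def using assms(4) by (rule I.a_rcos_self)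
  ultimately have "(\<lambda>k. X2_class p (poly_reduce p k)) ` X2_class n g = {X2_class p (poly_reduce p g)}"
    by blast
  then show ?thesis unfolding crt_component_def by (simp only: the_elem_eq)
qed

end

theory Submission
  imports Defs
begin

text \<open>
  The projection to each factor is a ring homomorphism, so \<open>u \<in> Rv\<close> forces
  \<open>\<langle>u\<^sub>p\<rangle> \<subseteq> \<langle>v\<^sub>p\<rangle>\<close>, and similarly for \<open>q\<close> and \<open>r\<close>. The ideals \<open>\<langle>0\<rangle>\<close>, \<open>\<langle>x\<rangle>\<close> and the whole ring
  form a strictly increasing chain in each factor, so a factor in which the index of \<open>u\<close> exceeds
  that of \<open>v\<close> excludes \<open>u \<in> Rv\<close>.
\<close>

lemma (in cring) cgenideal_mono:
  assumes "b \<in> carrier R" "a \<in> PIdl b"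
  shows "PIdl a \<subseteq> PIdl b"
  using assms by (intro cgenideal_minimal cgenideal_ideal)

lemma (in ring_hom_cring) hom_mem_cgenideal:
  assumes "b \<in> carrier R" "a \<in> PIdl\<^bsub>R\<^esub> b"
  shows "h a \<in> PIdl\<^bsub>S\<^esub> (h b)"
  using assms by (auto simp: cgenideal_def)

lemma cring_Zmod_X2:
  assumes "n > 1"
  shows "cring (Zmod_X2 n)"
proof -
  interpret UP_cring "residue_ring (int n)" "Zmod_poly n"
    using UP_cring_Zmod[OF assms] by simp_all
  show ?thesis
    unfolding Zmod_X2_def by (rule ideal.quotient_is_cring[OF ideal_X2[OF assms] P.is_cring])
qed

lemma X2_class_hom:
  assumes "n > 1"
  shows "X2_class n \<in> ring_hom (Zmod_poly n) (Zmod_X2 n)"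
  unfolding Zmod_X2_def X2_class_def[abs_def]
  using ideal.rcos_ring_hom[OF ideal_X2[OF assms]] .

lemma carrier_Zmod_X2: "carrier (Zmod_X2 n) = X2_class n ` carrier (Zmod_poly n)"
  by (auto simp: Zmod_X2_def X2_class_def FactRing_def A_RCOSETS_def')

text \<open>On classes of polynomials, \<open>crt_component p\<close> composed with
  \<open>X2_class n\<close> equals \<open>X2_class p\<close> composed with
  \<open>poly_reduce p\<close>, a composite of homomorphisms. Since \<open>X2_class n\<close> maps
  onto the quotient, the homomorphism laws can be checked on representatives.\<close>

lemma crt_component_hom:
  assumes "p > 1" "n > 1" "p dvd n"
  shows "crt_component p \<in> ring_hom (Zmod_X2 n) (Zmod_X2 p)"
proof -
  interpret N: UP_cring "residue_ring (int n)" "Zmod_poly n"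
    using UP_cring_Zmod[OF assms(2)] by simp_all
  interpret M: UP_cring "residue_ring (int p)" "Zmod_poly p"
    using UP_cring_Zmod[OF assms(1)] by simp_all
  interpret QN: cring "Zmod_X2 n" using assms(2) by (rule cring_Zmod_X2)
  interpret QM: cring "Zmod_X2 p" using assms(1) by (rule cring_Zmod_X2)
  interpret h: ring_hom_cring "Zmod_poly n" "Zmod_poly p" "poly_reduce p"
    using poly_reduce_hom[OF assms] by unfold_locales
  interpret a: ring_hom_cring "Zmod_poly n" "Zmod_X2 n" "X2_class n"
    using X2_class_hom[OF assms(2)] by unfold_locales
  interpret b: ring_hom_cring "Zmod_poly p" "Zmod_X2 p" "X2_class p"
    using X2_class_hom[OF assms(1)] by unfold_locales
  note crt = crt_component_class[OF assms]
  show ?thesis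
  proof (rule ring_hom_memI)
    fix f assume "f \<in> carrier (Zmod_X2 n)"
    then show "crt_component p f \<in> carrier (Zmod_X2 p)"
      by (auto simp: carrier_Zmod_X2 crt)
  next
    fix f g assume "f \<in> carrier (Zmod_X2 n)" "g \<in> carrier (Zmod_X2 n)"
    then obtain f' g' where c: "f' \<in> carrier (Zmod_poly n)" "g' \<in> carrier (Zmod_poly n)"
      and fg: "f = X2_class n f'" "g = X2_class n g'"
      by (auto simp: carrier_Zmod_X2)
    show "crt_component p (f \<otimes>\<^bsub>Zmod_X2 n\<^esub> g)
        = crt_component p f \<otimes>\<^bsub>Zmod_X2 p\<^esub> crt_component p g"
      using c by (simp add: fg crt flip: a.hom_mult b.hom_mult)
    show "crt_component p (f \<oplus>\<^bsub>Zmod_X2 n\<^esub> g)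
        = crt_component p f \<oplus>\<^bsub>Zmod_X2 p\<^esub> crt_component p g"
      using c by (simp add: fg crt flip: a.hom_add b.hom_add)
  next
    show "crt_component p \<one>\<^bsub>Zmod_X2 n\<^esub> = \<one>\<^bsub>Zmod_X2 p\<^esub>"
      by (simp add: crt flip: a.hom_one b.hom_one)
  qed
qed

lemma poly_X_closed:
  assumes "n > 1"
  shows "poly_X n \<in> carrier (Zmod_poly n)"
proof -
  interpret UP_cring "residue_ring (int n)" "Zmod_poly n"
    using UP_cring_Zmod[OF assms] by simp_all
  show ?thesis unfolding poly_X_def by (intro monom_closed R.one_closed)
qed

text \<open>Every multiple of x^2 has coefficient 0 at degree 1, whereas x has coefficient 1 there,
  and 1 differs from 0 modulo n.\<close>

lemma poly_X_notin_X2_ideal: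
  assumes "n > 1"
  shows "poly_X n \<notin> X2_ideal n"
proof
  interpret UP_cring "residue_ring (int n)" "Zmod_poly n"
    using UP_cring_Zmod[OF assms] by simp_all
  let ?R = "residue_ring (int n)"
  have sq: "poly_X n [^]\<^bsub>Zmod_poly n\<^esub> (2::nat) = monom (Zmod_poly n) \<one>\<^bsub>?R\<^esub> 2"
    using monom_pow[of "\<one>\<^bsub>?R\<^esub>" 1 2] by (simp add: poly_X_def)
  assume "poly_X n \<in> X2_ideal n"
  then obtain a where a: "a \<in> carrier (Zmod_poly n)"
    and eq: "monom (Zmod_poly n) \<one>\<^bsub>?R\<^esub> 1 = a \<otimes>\<^bsub>Zmod_poly n\<^esub> monom (Zmod_poly n) \<one>\<^bsub>?R\<^esub> 2"
    \<comment> \<open>\<open>poly_X\<close> stays folded until \<open>sq\<close>, which matches the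
      folded form, has rewritten the power.\<close>
    by (auto simp: X2_ideal_def cgenideal_def sq) (auto simp: poly_X_def)
  have "\<one>\<^bsub>?R\<^esub> = coeff (Zmod_poly n) (monom (Zmod_poly n) \<one>\<^bsub>?R\<^esub> 1) 1"
    by simp
  also have "\<dots> = \<zero>\<^bsub>?R\<^esub>"
    \<comment> \<open>The coefficient is a convolution sum over i \<le> 1, and x^2 has coefficient 0
      at every degree 1 - i.\<close>
    unfolding eq using a by (simp add: numeral_2_eq_2)
  finally show False
    using assms by (simp add: residue_ring_def)
qed

text \<open>The zero of the quotient is the ideal itself as a set; the coset of x contains x, which
  lies outside that ideal.\<close>

lemma X2_class_X_neq_zero:
  assumes "n > 1"
  shows "X2_class n (poly_X n) \<noteq> \<zero>\<^bsub>Zmod_X2 n\<^esub>"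
proof -
  interpret ideal "X2_ideal n" "Zmod_poly n" using assms by (rule ideal_X2)
  have "poly_X n \<in> X2_class n (poly_X n)"
    unfolding X2_class_def using poly_X_closed[OF assms] by (rule a_rcos_self)
  then show ?thesis
    using poly_X_notin_X2_ideal[OF assms] by (auto simp: Zmod_X2_def FactRing_def)
qed

lemma X2_class_X_square:
  assumes "n > 1"
  shows "X2_class n (poly_X n) \<otimes>\<^bsub>Zmod_X2 n\<^esub> X2_class n (poly_X n) = \<zero>\<^bsub>Zmod_X2 n\<^esub>"
proof -
  interpret UP_cring "residue_ring (int n)" "Zmod_poly n"
    using UP_cring_Zmod[OF assms] by simp_all
  interpret ideal "X2_ideal n" "Zmod_poly n" using assms by (rule ideal_X2)
  note X = poly_X_closed[OF assms]
  have "poly_X n \<otimes>\<^bsub>Zmod_poly n\<^esub> poly_X n \<in> X2_ideal n"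
    unfolding X2_ideal_def
    using X P.cgenideal_self[of "poly_X n [^]\<^bsub>Zmod_poly n\<^esub> (2::nat)"]
    by (simp add: numeral_2_eq_2)
  then have "X2_class n (poly_X n \<otimes>\<^bsub>Zmod_poly n\<^esub> poly_X n) = X2_ideal n"
    unfolding X2_class_def by (rule a_coset_join2[OF P.m_closed[OF X X] a_subgroup])
  then show ?thesis
    using ring_hom_mult[OF X2_class_hom[OF assms] X X] by (simp add: Zmod_X2_def FactRing_def)
qed

text \<open>Explicit elements separate the ideals: the class of x is nonzero, so it lies in the
  second and third ideals but not in the first, and 1 lies in the third but not in the second,
  because x is nilpotent.\<close>

lemma chain_ideal_strict:
  assumes "p > 1" "i \<in> {1, 2, 3}" "j \<in> {1, 2, 3}" "i < j"
  shows "\<not> chain_ideal p j \<subseteq> chain_ideal p i"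
proof -
  interpret cring "Zmod_X2 p" using assms(1) by (rule cring_Zmod_X2)
  let ?x = "X2_class p (poly_X p)"
  have x: "?x \<in> carrier (Zmod_X2 p)"
    using poly_X_closed[OF assms(1)] by (simp add: carrier_Zmod_X2)
  have x0: "?x \<notin> PIdl\<^bsub>Zmod_X2 p\<^esub> \<zero>\<^bsub>Zmod_X2 p\<^esub>"
    using X2_class_X_neq_zero[OF assms(1)] cgenideal_eq_genideal[OF zero_closed] genideal_zero
    by simp
  have "\<one>\<^bsub>Zmod_X2 p\<^esub> \<notin> PIdl\<^bsub>Zmod_X2 p\<^esub> ?x"
  proof
    assume "\<one>\<^bsub>Zmod_X2 p\<^esub> \<in> PIdl\<^bsub>Zmod_X2 p\<^esub> ?x"
    then obtain a where a: "a \<in> carrier (Zmod_X2 p)" "\<one>\<^bsub>Zmod_X2 p\<^esub> = a \<otimes>\<^bsub>Zmod_X2 p\<^esub> ?x"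
      by (auto simp: cgenideal_def)
    \<comment> \<open>Multiplying 1 = ax by x gives x = ax^2, which is 0 in the quotient.\<close>
    have "?x = a \<otimes>\<^bsub>Zmod_X2 p\<^esub> (?x \<otimes>\<^bsub>Zmod_X2 p\<^esub> ?x)"
      using a x by (metis l_one m_assoc)
    then show False
      using a(1) X2_class_X_square[OF assms(1)] X2_class_X_neq_zero[OF assms(1)] by simp
  qed
  then show ?thesis
    using assms(2-4) x x0 cgenideal_self[OF x] by (auto simp: chain_ideal_def)
qed

text \<open>Stated for one divisor \<open>d\<close> so that the three factors are treated alike. If
  \<open>g\<close> were a multiple of \<open>f\<close>, its image would be a multiple of the image
  of \<open>f\<close>, making the larger chain ideal a subset of the smaller.\<close>

lemma notin_cgenideal_if_chain_ideal_less:
  assumes "d > 1" "n > 1" "d dvd n" "f \<in> carrier (Zmod_X2 n)" "g \<in> carrier (Zmod_X2 n)"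
    and "PIdl\<^bsub>Zmod_X2 d\<^esub> (crt_component d f) = chain_ideal d i"
    and "PIdl\<^bsub>Zmod_X2 d\<^esub> (crt_component d g) = chain_ideal d j"
    and "i \<in> {1, 2, 3}" "j \<in> {1, 2, 3}" "i < j"
  shows "g \<notin> PIdl\<^bsub>Zmod_X2 n\<^esub> f"
proof
  interpret N: cring "Zmod_X2 n" using assms(2) by (rule cring_Zmod_X2)
  interpret D: cring "Zmod_X2 d" using assms(1) by (rule cring_Zmod_X2)
  interpret ring_hom_cring "Zmod_X2 n" "Zmod_X2 d" "crt_component d"
    using crt_component_hom[OF assms(1-3)] by unfold_locales
  assume "g \<in> PIdl\<^bsub>Zmod_X2 n\<^esub> f"
  with assms(4) have "PIdl\<^bsub>Zmod_X2 d\<^esub> (crt_component d g) \<subseteq> PIdl\<^bsub>Zmod_X2 d\<^esub> (crt_component d f)"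
    by (intro D.cgenideal_mono hom_mem_cgenideal hom_closed)
  then show False
    using chain_ideal_strict[OF assms(1,8-10)] assms(6,7) by simp
qed

text \<open>One strict inequality of indices excludes one of the two memberships; the position
  \<open>i\<close> selects the factor p, q or r in which the ideals are compared.\<close>

lemma ideal_type_class_notin_cgenideal:
  fixes x y :: "nat \<Rightarrow> nat"
  assumes "p > 1" "q > 1" "r > 1"
    and f: "f \<in> ideal_type_class p q r (x 1) (x 2) (x 3)"
    and g: "g \<in> ideal_type_class p q r (y 1) (y 2) (y 3)"
    and "x \<in> {1, 2, 3} \<rightarrow> {1, 2, 3}" "y \<in> {1, 2, 3} \<rightarrow> {1, 2, 3}"
    and i: "i \<in> {1, 2, 3}" "x i < y i"
  shows "g \<notin> PIdl\<^bsub>Zmod_X2 (p * q * r)\<^esub> f"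
proof -
  have n: "p * q * r > 1"
    using assms(1-3) by (metis less_1_mult)
  have xy: "x i \<in> {1, 2, 3}" "y i \<in> {1, 2, 3}"
    using assms(6,7) i(1) by blast+
  have fg: "f \<in> carrier (Zmod_X2 (p * q * r))" "g \<in> carrier (Zmod_X2 (p * q * r))"
    using f g by (auto simp: ideal_type_class_def)
  note * = notin_cgenideal_if_chain_ideal_less[OF _ n _ fg _ _ xy i(2)]
  consider "i = 1" | "i = 2" | "i = 3" using i(1) by blast
  then show ?thesis
  proof cases
    case 1
    then show ?thesis using f g assms(1) by (intro *[of p]) (auto simp: ideal_type_class_def)
  next
    case 2
    then show ?thesis using f g assms(2) by (intro *[of q]) (auto simp: ideal_type_class_def)
  next
    case 3
    then show ?thesis using f g assms(3) by (intro *[of r]) (auto simp: ideal_type_class_def)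
  qed
qed

theorem theorem3p8:
  fixes p q r :: nat and x y :: "nat \<Rightarrow> nat"
  assumes "prime p" "prime q" "prime r"
    and "p \<noteq> q" "p \<noteq> r" "q \<noteq> r"
    and "x \<in> {1, 2, 3} \<rightarrow> {1, 2, 3}" "y \<in> {1, 2, 3} \<rightarrow> {1, 2, 3}"
    and "\<exists>i \<in> {1, 2, 3}. \<exists>j \<in> {1, 2, 3}. x i < y i \<and> x j > y j"
  shows "let G = cozero_divisor_graph (Zmod_X2 (p * q * r)) in
         \<forall>u \<in> pverts G \<inter> ideal_type_class p q r (x 1) (x 2) (x 3).
           \<forall>v \<in> pverts G \<inter> ideal_type_class p q r (y 1) (y 2) (y 3).
             u \<rightarrow>\<^bsub>with_proj G\<^esub> v"
proof -
  have gt: "p > 1" "q > 1" "r > 1"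
    using assms(1-3)[THEN prime_gt_1_nat] by simp_all
  then have "p * q * r > 1"
    by (metis less_1_mult)
  then interpret cring "Zmod_X2 (p * q * r)" by (rule cring_Zmod_X2)
  obtain i j where ij: "i \<in> {1, 2, 3}" "x i < y i" "j \<in> {1, 2, 3}" "y j < x j"
    using assms(9) by blast
  have "u \<notin> PIdl\<^bsub>Zmod_X2 (p * q * r)\<^esub> v \<and> v \<notin> PIdl\<^bsub>Zmod_X2 (p * q * r)\<^esub> u \<and> u \<noteq> v"
    if u: "u \<in> ideal_type_class p q r (x 1) (x 2) (x 3)"
      and v: "v \<in> ideal_type_class p q r (y 1) (y 2) (y 3)" for u v
  proof -
    have "v \<notin> PIdl\<^bsub>Zmod_X2 (p * q * r)\<^esub> u"
      by (rule ideal_type_class_notin_cgenideal[OF gt u v assms(7,8) ij(1,2)])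
    \<comment> \<open>The same argument at position \<open>j\<close>, with the roles of the two
      classes exchanged.\<close>
    moreover have "u \<notin> PIdl\<^bsub>Zmod_X2 (p * q * r)\<^esub> v"
      by (rule ideal_type_class_notin_cgenideal[OF gt v u assms(8,7) ij(3,4)])
    \<comment> \<open>This yields \<open>u \<noteq> v\<close>: \<open>u\<close> lies in its own
      principal ideal but not in that of \<open>v\<close>.\<close>
    moreover have "u \<in> PIdl\<^bsub>Zmod_X2 (p * q * r)\<^esub> u"
      using u by (intro cgenideal_self) (simp add: ideal_type_class_def)
    ultimately show ?thesis by blast
  qed
  then show ?thesis
    \<comment> \<open>Adjacency in \<open>with_proj G\<close> is membership of the pair in
      \<open>parcs\<close>; that \<open>u\<close> and \<open>v\<close> are nonzero non-units comes
      from the restriction to \<open>pverts G\<close>.\<close>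
    by (auto simp: Let_def cozero_divisor_graph_def arcs_ends_conv)
qed

end
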